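(* Let $\pi=(d_{1},\ldots,d_{n})$ be a non-increasing graphic sequence. Let $k\leq d_{n}$ be a non-negative integer such that $kn$ is even. If $$d_{d_{1}-d_{n}+1}\geq d_{1}-d_{n}+k-1,$$ then some realization of $\pi$ has a $k$-factor.
   Context: A sequence of non-negative integers is graphic if it is the degree sequence of some finite simple graph, called a realization of it. A $k$-factor of a graph is a $k$-regular spanning subgraph. *)

theory Defs
  imports Main
begin

text \<open>A finite simple graph is given by its vertex set \<open>V\<close> and its edge set \<open>E\<close>, edges being
  two-element subsets of \<open>V\<close>.\<close>

definition simple_graph :: "'a set \<Rightarrow> 'a set set \<Rightarrow> bool" where
  "simple_graph V E \<longleftrightarrow> finite V \<and> (\<forall>e\<in>E. e \<subseteq> V \<and> card e = 2)"

definition degree :: "'a set set \<Rightarrow> 'a \<Rightarrow> nat" where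
  "degree E v = card {e \<in> E. v \<in> e}"

text \<open>A sequence of length \<open>n\<close> is a function of which only the values at \<open>1, \<dots>, n\<close> matter.\<close>

definition realization :: "nat \<Rightarrow> (nat \<Rightarrow> nat) \<Rightarrow> 'a set \<Rightarrow> 'a set set \<Rightarrow> bool" where
  "realization n d V E \<longleftrightarrow> simple_graph V E \<and>
     (\<exists>v. bij_betw v {1..n} V \<and> (\<forall>i\<in>{1..n}. degree E (v i) = d i))"

text \<open>Every finite graph is isomorphic to one on natural numbers, so taking vertices
  in \<^typ>\<open>nat\<close> is no restriction.\<close>

definition graphic :: "nat \<Rightarrow> (nat \<Rightarrow> nat) \<Rightarrow> bool" where
  "graphic n d \<longleftrightarrow> (\<exists>(V :: nat set) E. realization n d V E)"

definition subgraph :: "'a set \<Rightarrow> 'a set set \<Rightarrow> 'a set \<Rightarrow> 'a set set \<Rightarrow> bool" where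
  "subgraph W F V E \<longleftrightarrow> simple_graph W F \<and> W \<subseteq> V \<and> F \<subseteq> E"

definition regular :: "nat \<Rightarrow> 'a set \<Rightarrow> 'a set set \<Rightarrow> bool" where
  "regular k V E \<longleftrightarrow> (\<forall>v\<in>V. degree E v = k)"

text \<open>A spanning subgraph keeps all vertices, so a factor is determined by its edge set \<open>F\<close>.\<close>

definition has_factor :: "nat \<Rightarrow> 'a set \<Rightarrow> 'a set set \<Rightarrow> bool" where
  "has_factor k V E \<longleftrightarrow> (\<exists>F. subgraph V F V E \<and> regular k V F)"

end

theory Submission imports Defs
begin

text \<open>The lowered sequence \<open>d i - k\<close> satisfies the Erdos--Gallai inequalities: at index \<open>t\<close>, with
  \<open>m = d 1 - d n\<close>, they follow either from crude bounds on its entries or from the inequalities for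
  \<open>d\<close>, depending on whether at least \<open>t\<close> or at most \<open>t\<close> indices lie beyond \<open>max t (m + 1)\<close>;
  in one borderline case both bounds miss by one and parity decides. Hence \<open>d\<close> and \<open>d - k\<close> have
  realizations \<open>G\<close> and \<open>H\<close> on the same vertices, and minimising the number of edges in \<open>H - G\<close> by
  switchings forces \<open>H \<subseteq> G\<close>, so that \<open>G - H\<close> is a \<open>k\<close>-factor (Chen's proof of Kundu's theorem).
  Sufficiency of the Erdos--Gallai inequalities is shown as by Tripathi, Venugopalan and West.\<close>

section \<open>Neighbourhoods, degrees and double counting in finite simple graphs\<close>

definition nbrs :: "'a set set \<Rightarrow> 'a \<Rightarrow> 'a set" where
  "nbrs E v = {w. {v, w} \<in> E}"

lemma mem_nbrs: "w \<in> nbrs E v \<longleftrightarrow> {v, w} \<in> E"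
  by (simp add: nbrs_def)

lemma nbrs_sym: "w \<in> nbrs E v \<longleftrightarrow> v \<in> nbrs E w"
  by (simp add: nbrs_def insert_commute)

lemma simple_graph_finite_edges:
  assumes "simple_graph V E" shows "finite E"
proof (rule finite_subset)
  show "E \<subseteq> Pow V" using assms by (auto simp: simple_graph_def)
  show "finite (Pow V)" using assms by (simp add: simple_graph_def)
qed

lemma simple_graph_edgeD:
  assumes "simple_graph V E" "{v, w} \<in> E"
  shows "v \<in> V" "w \<in> V" "v \<noteq> w"
  using assms by (fastforce simp: simple_graph_def)+

lemma simple_graph_mono: "simple_graph V E \<Longrightarrow> F \<subseteq> E \<Longrightarrow> simple_graph V F"
  by (auto simp: simple_graph_def)

lemma simple_graph_insert:
  "simple_graph V E \<Longrightarrow> a \<in> V \<Longrightarrow> b \<in> V \<Longrightarrow> a \<noteq> b \<Longrightarrow> simple_graph V (insert {a, b} E)"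
  by (auto simp: simple_graph_def)

lemma nbrs_subset:
  assumes "simple_graph V E" shows "nbrs E v \<subseteq> V - {v}"
  using simple_graph_edgeD[OF assms] by (metis DiffI mem_nbrs singletonD subsetI)

lemma finite_nbrs: "simple_graph V E \<Longrightarrow> finite (nbrs E v)"
  by (meson finite_Diff finite_subset nbrs_subset simple_graph_def)

lemma degree_eq_card_nbrs:
  assumes "simple_graph V E" shows "degree E v = card (nbrs E v)"
proof -
  have "{e \<in> E. v \<in> e} \<subseteq> (\<lambda>w. {v, w}) ` nbrs E v"
  proof
    fix e assume "e \<in> {e \<in> E. v \<in> e}"
    then have e: "e \<in> E" "v \<in> e" by auto
    then have "card e = 2" using assms by (simp add: simple_graph_def)
    then obtain a b where ab: "e = {a, b}" by (auto simp: card_2_iff)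
    have "e = {v, a} \<or> e = {v, b}" using e(2) unfolding ab by blast
    then show "e \<in> (\<lambda>w. {v, w}) ` nbrs E v" using e(1) by (auto simp: mem_nbrs)
  qed
  then have "{e \<in> E. v \<in> e} = (\<lambda>w. {v, w}) ` nbrs E v"
    by (auto simp: mem_nbrs)
  moreover have "inj_on (\<lambda>w. {v, w}) (nbrs E v)"
    by (auto simp: inj_on_def doubleton_eq_iff)
  ultimately show ?thesis by (simp add: degree_def card_image)
qed

lemma degree_insert:
  assumes "finite E" "f \<notin> E"
  shows "degree (insert f E) v = degree E v + (if v \<in> f then 1 else 0)"
proof (cases "v \<in> f")
  case True
  then have "{e \<in> insert f E. v \<in> e} = insert f {e \<in> E. v \<in> e}" by auto
  then show ?thesis using True assms by (simp add: degree_def)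
next
  case False
  then have "{e \<in> insert f E. v \<in> e} = {e \<in> E. v \<in> e}" by auto
  then show ?thesis using False by (simp add: degree_def)
qed

lemma degree_remove:
  assumes "finite E" "f \<in> E"
  shows "degree E v = degree (E - {f}) v + (if v \<in> f then 1 else 0)"
  using degree_insert[of "E - {f}" f v] assms by (simp add: insert_absorb)

lemma degree_mono:
  assumes "finite E" "F \<subseteq> E" shows "degree F v \<le> degree E v"
  unfolding degree_def using assms by (intro card_mono) auto

lemma degree_diff:
  assumes "finite G"
  shows "degree G v = degree (G - H) v + degree (G \<inter> H) v"
proof -
  have "{e \<in> G. v \<in> e} = {e \<in> G - H. v \<in> e} \<union> {e \<in> G \<inter> H. v \<in> e}" by auto
  also have "card \<dots> = card {e \<in> G - H. v \<in> e} + card {e \<in> G \<inter> H. v \<in> e}"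
    using assms by (intro card_Un_disjoint) auto
  finally show ?thesis by (simp add: degree_def)
qed

text \<open>The handshake lemma: incidences are counted by vertices and then by edges.\<close>

lemma sum_degree:
  assumes "simple_graph V E" shows "(\<Sum>v\<in>V. degree E v) = 2 * card E"
proof -
  have fin: "finite V" "finite E"
    using assms simple_graph_finite_edges by (auto simp: simple_graph_def)
  have "(\<Sum>v\<in>V. degree E v) = (\<Sum>v\<in>V. \<Sum>e | e \<in> E \<and> v \<in> e. 1)"
    by (simp add: degree_def)
  also have "\<dots> = (\<Sum>e\<in>E. \<Sum>v | v \<in> V \<and> v \<in> e. 1)"
    using fin by (rule sum.swap_restrict)
  also have "\<dots> = (\<Sum>e\<in>E. 2)"
  proof (rule sum.cong)
    fix e assume "e \<in> E"
    then have "{v. v \<in> V \<and> v \<in> e} = e" "card e = 2"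
      using assms by (auto simp: simple_graph_def)
    then show "(\<Sum>v | v \<in> V \<and> v \<in> e. 1) = (2::nat)" by simp
  qed simp
  finally show ?thesis by simp
qed

text \<open>Both sides count the pairs from \<open>A\<close> and \<open>B\<close> that are joined by
  an edge.\<close>

lemma sum_card_nbrs_swap:
  assumes "finite A" "finite B"
  shows "(\<Sum>a\<in>A. card (nbrs E a \<inter> B)) = (\<Sum>b\<in>B. card (nbrs E b \<inter> A))"
proof -
  have "(\<Sum>a\<in>A. card (nbrs E a \<inter> B)) = (\<Sum>a\<in>A. \<Sum>b | b \<in> B \<and> {a, b} \<in> E. 1)"
    by (intro sum.cong) (auto simp: mem_nbrs intro!: arg_cong[where f = card])
  also have "\<dots> = (\<Sum>b\<in>B. \<Sum>a | a \<in> A \<and> {a, b} \<in> E. 1)"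
    using assms by (rule sum.swap_restrict)
  also have "\<dots> = (\<Sum>b\<in>B. card (nbrs E b \<inter> A))"
    by (intro sum.cong) (auto simp: mem_nbrs insert_commute intro!: arg_cong[where f = card])
  finally show ?thesis .
qed

section \<open>Relabelling the vertices of a realization\<close>

lemma degree_image:
  assumes "inj_on f V" "simple_graph V E" "v \<in> V"
  shows "degree ((`) f ` E) (f v) = degree E v"
proof -
  have sub: "\<And>e. e \<in> E \<Longrightarrow> e \<subseteq> V" using assms by (auto simp: simple_graph_def)
  have "f v \<in> f ` e \<longleftrightarrow> v \<in> e" if "e \<in> E" for e
    using inj_on_image_mem_iff[OF assms(1,3) sub[OF that]] .
  then have "{e \<in> (`) f ` E. f v \<in> e} = (`) f ` {e \<in> E. v \<in> e}" by blast
  moreover have "inj_on ((`) f) {e \<in> E. v \<in> e}"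
    by (rule inj_onI) (use inj_on_image_eq_iff[OF assms(1)] sub in blast)
  ultimately show ?thesis by (simp add: degree_def card_image)
qed

lemma simple_graph_image:
  assumes "inj_on f V" "simple_graph V E"
  shows "simple_graph (f ` V) ((`) f ` E)"
proof -
  have "card (f ` e) = 2" if "e \<in> E" for e
    using that assms by (metis card_image inj_on_subset simple_graph_def)
  then show ?thesis using assms by (auto simp: simple_graph_def)
qed

text \<open>Relabelling along the inverse of the enumeration puts a realization on
  \<open>{1..n}\<close>. Realizations of two sequences thus share their labelled vertices, as
  Kundu's theorem needs.\<close>

lemma graphic_iff:
  "graphic n d \<longleftrightarrow> (\<exists>E. simple_graph {1..n} E \<and> (\<forall>i\<in>{1..n}. degree E i = d i))"
proof
  assume "graphic n d"
  then obtain V :: "nat set" and E v where E: "simple_graph V E" and v: "bij_betw v {1..n} V"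
    and deg: "\<forall>i\<in>{1..n}. degree E (v i) = d i"
    unfolding graphic_def realization_def by blast
  define f where "f = inv_into {1..n} v"
  have f: "bij_betw f V {1..n}" unfolding f_def by (rule bij_betw_inv_into[OF v])
  then have inj: "inj_on f V" and im: "f ` V = {1..n}" by (auto simp: bij_betw_def)
  have "degree ((`) f ` E) i = d i" if "i \<in> {1..n}" for i
  proof -
    have "v i \<in> V" "f (v i) = i"
      using that v by (auto simp: f_def bij_betw_def)
    then show ?thesis using degree_image[OF inj E, of "v i"] deg that by simp
  qed
  then show "\<exists>E. simple_graph {1..n} E \<and> (\<forall>i\<in>{1..n}. degree E i = d i)"
    using simple_graph_image[OF inj E] im by auto
next
  assume "\<exists>E. simple_graph {1..n} E \<and> (\<forall>i\<in>{1..n}. degree E i = d i)"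
  then show "graphic n d"
    unfolding graphic_def realization_def using bij_betw_id[of "{1..n}"] by (metis id_apply)
qed

section \<open>Kundu's theorem\<close>

text \<open>The four ends are distinct, and each loses one edge and gains one.\<close>

lemma switch:
  assumes "simple_graph V E" "{a, b} \<in> E" "{c, d} \<in> E" "{a, c} \<notin> E" "{b, d} \<notin> E"
    and "a \<noteq> c" "a \<noteq> d" "b \<noteq> c" "b \<noteq> d"
  defines "E' \<equiv> insert {a, c} (insert {b, d} (E - {{a, b}} - {{c, d}}))"
  shows "simple_graph V E'" "degree E' v = degree E v"
proof -
  note ab = simple_graph_edgeD[OF assms(1,2)] and cd = simple_graph_edgeD[OF assms(1,3)]
  show "simple_graph V E'"
    unfolding E'_def using assms ab cd
    by (intro simple_graph_insert) (auto intro: simple_graph_mono)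
  have fin: "finite E" by (rule simple_graph_finite_edges[OF assms(1)])
  have 1: "degree E v = degree (E - {{a, b}}) v + (if v \<in> {a, b} then 1 else 0)"
    using fin assms by (intro degree_remove) auto
  have 2: "degree (E - {{a, b}}) v =
      degree (E - {{a, b}} - {{c, d}}) v + (if v \<in> {c, d} then 1 else 0)"
    using fin assms by (intro degree_remove) (auto simp: doubleton_eq_iff)
  have 3: "degree (insert {b, d} (E - {{a, b}} - {{c, d}})) v =
      degree (E - {{a, b}} - {{c, d}}) v + (if v \<in> {b, d} then 1 else 0)"
    using fin assms by (intro degree_insert) auto
  have 4: "degree E' v =
      degree (insert {b, d} (E - {{a, b}} - {{c, d}})) v + (if v \<in> {a, c} then 1 else 0)"
    unfolding E'_def using fin assms ab cd by (intro degree_insert) (auto simp: doubleton_eq_iff)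
  show "degree E' v = degree E v"
    unfolding 1 2 4 3 using assms ab cd by auto
qed

text \<open>Two elements leave and at most one enters. This measures switchings that take two edges
  out of \<open>H - G\<close> and may put one in.\<close>

lemma card_exchange_less:
  assumes "finite A" "a \<in> A" "b \<in> A" "a \<noteq> b" "B \<subseteq> insert c (A - {a, b})"
  shows "card B < card A"
proof -
  have "card B \<le> card (insert c (A - {a, b}))" using assms by (intro card_mono) auto
  also have "\<dots> \<le> Suc (card (A - {a, b}))" by (rule card_insert_le_m1) auto
  finally show ?thesis
    using assms card_Diff_subset[of "{a, b}" A] card_mono[of A "{a, b}"] by auto
qed

text \<open>The exceptional elements \<open>z\<close> of \<open>X\<close> and \<open>y\<close> of
  \<open>Y\<close> balance each other, and \<open>x\<close> is a surplus of \<open>Y\<close>. For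
  neighbourhoods of two vertices the exceptions are these vertices themselves, balanced by symmetry
  of adjacency.\<close>

lemma card_less_by_exchange:
  assumes "finite X" "finite Y" "X - {z} \<subseteq> Y - {x, y}" "x \<in> Y" "z \<in> X \<longleftrightarrow> y \<in> Y" "x \<noteq> y"
  shows "card X < card Y"
proof -
  have "card (X - {z}) \<le> card (Y - {x, y})" using assms by (intro card_mono) auto
  also have "Y - {x, y} = Y - {y} - {x}" by auto
  also have "card \<dots> < card (Y - {y})" using assms by (intro card_Diff1_less) auto
  finally show ?thesis
    using assms by (cases "z \<in> X") (auto simp: card_Diff_singleton dest: card_gt_0_iff[THEN iffD2])
qed

text \<open>If \<open>xy\<close> is an edge of \<open>H - G\<close> and \<open>xz\<close> one of \<open>G - H\<close>, and no switching on \<open>x, y, z, w\<close> in \<open>G\<close> or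
  in \<open>H\<close> helps, then \<open>z\<close> has more neighbours in \<open>G - H\<close> and fewer in \<open>H - G\<close> than \<open>y\<close>, although
  these numbers differ by \<open>k\<close> at both vertices.\<close>

lemma kundu_step:
  assumes G: "simple_graph V G" and H: "simple_graph V H"
    and deg: "\<And>v. v \<in> V \<Longrightarrow> degree G v = degree H v + k"
    and ne: "\<not> H \<subseteq> G"
  obtains G' H' where "simple_graph V G'" "simple_graph V H'"
    "\<And>v. degree G' v = degree G v" "\<And>v. degree H' v = degree H v"
    "card (H' - G') < card (H - G)"
proof (rule ccontr)
  note step = that
  note finG = simple_graph_finite_edges[OF G] and finH = simple_graph_finite_edges[OF H]
  assume "\<not> thesis"
  \<comment> \<open>With no improving pair, switching only one of the two graphs cannot help
    either.\<close>
  then have minG: "\<not> card (H - G') < card (H - G)"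
    if "simple_graph V G'" "\<And>v. degree G' v = degree G v" for G'
    using \<open>\<not> thesis\<close> that H step[of G' H] by blast
  have minH: "\<not> card (H' - G) < card (H - G)"
    if "simple_graph V H'" "\<And>v. degree H' v = degree H v" for H'
    using \<open>\<not> thesis\<close> that G step[of G H'] by blast
  define R where "R = nbrs (G - H)"
  define B where "B = nbrs (H - G)"
  have RG: "simple_graph V (G - H)" and BH: "simple_graph V (H - G)"
    using G H by (auto intro: simple_graph_mono)
  \<comment> \<open>The common edges of \<open>G\<close> and \<open>H\<close> cancel, so the two
    differences carry the excess \<open>k\<close>.\<close>
  have RB: "card (R v) = card (B v) + k" if "v \<in> V" for v
    using deg[OF that] degree_diff[OF finG, of v H] degree_diff[OF finH, of v G]
      degree_eq_card_nbrs[OF RG, of v] degree_eq_card_nbrs[OF BH, of v]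
    by (simp add: R_def B_def Int_commute)
  have fin: "finite (R v)" "finite (B v)" for v
    unfolding R_def B_def by (rule finite_nbrs[OF RG], rule finite_nbrs[OF BH])
  obtain f where f: "f \<in> H" "f \<notin> G" using ne by blast
  then obtain x y where xy: "{x, y} \<in> H" "{x, y} \<notin> G"
    using H by (auto simp: simple_graph_def card_2_iff)
  note xyV = simple_graph_edgeD[OF H xy(1)]
  have "y \<in> B x" using xy by (simp add: B_def mem_nbrs)
  \<comment> \<open>As \<open>y\<close> lies in \<open>B x\<close>, the set \<open>R x\<close> is
    nonempty even for \<open>k = 0\<close>.\<close>
  then have "card (R x) > 0" using RB[OF xyV(1)] fin[of x] by (auto simp: card_gt_0_iff)
  then obtain z where "z \<in> R x" by (metis all_not_in_conv card.empty less_irrefl)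
  then have xz: "{x, z} \<in> G" "{x, z} \<notin> H" by (simp_all add: R_def mem_nbrs)
  note xzV = simple_graph_edgeD[OF G xz(1)]
  have yz: "y \<noteq> z" using xy xz by auto
  \<comment> \<open>Trading \<open>xz, yw\<close> for \<open>xy, zw\<close> in \<open>G\<close>
    takes \<open>xy\<close> out of \<open>H - G\<close>. Only \<open>yw\<close> can enter, and
    \<open>zw\<close> leaves if it was there; so no gain forces \<open>yw\<close> into
    \<open>H\<close> and \<open>zw\<close> out of it.\<close>
  have 1: "{y, w} \<in> H \<and> {z, w} \<notin> H"
    if w: "w \<noteq> x" "w \<noteq> z" "{y, w} \<in> G" "{z, w} \<notin> G" for w
  proof -
    note ywV = simple_graph_edgeD[OF G w(3)]
    define G' where "G' = insert {x, y} (insert {z, w} (G - {{x, z}} - {{y, w}}))"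
    have "\<not> card (H - G') < card (H - G)"
      unfolding G'_def using w xy xz xyV xzV ywV yz
      by (intro minG switch[OF G]) auto
    moreover have "card (H - G') < card (H - G)" if "{y, w} \<notin> H"
      using that xy xz finH by (intro psubset_card_mono) (auto simp: G'_def)
    moreover have "card (H - G') < card (H - G)" if "{z, w} \<in> H"
      using that xy xz w finH xyV xzV
      by (intro card_exchange_less[of _ "{x, y}" "{z, w}" _ "{y, w}"])
        (auto simp: G'_def doubleton_eq_iff)
    ultimately show ?thesis by blast
  qed
  \<comment> \<open>Trading \<open>xy, zw\<close> for \<open>xz, yw\<close> in \<open>H\<close>
    takes \<open>xy\<close> out of \<open>H - G\<close>, and \<open>xz\<close> does not enter. No
    gain means that \<open>yw\<close> enters and \<open>zw\<close> was not there to leave.\<close>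
  have 2: "{z, w} \<in> G \<and> {y, w} \<notin> G"
    if w: "w \<noteq> x" "w \<noteq> y" "{y, w} \<notin> H" "{z, w} \<in> H" for w
  proof -
    note zwV = simple_graph_edgeD[OF H w(4)]
    define H' where "H' = insert {x, z} (insert {y, w} (H - {{x, y}} - {{z, w}}))"
    have "\<not> card (H' - G) < card (H - G)"
      unfolding H'_def using w xy xz xyV xzV zwV yz
      by (intro minH switch[OF H]) auto
    moreover have "card (H' - G) < card (H - G)" if "{y, w} \<in> G"
      using that xy xz finH by (intro psubset_card_mono) (auto simp: H'_def)
    moreover have "card (H' - G) < card (H - G)" if "{z, w} \<notin> G"
      using that xy xz w finH xyV xzV
      by (intro card_exchange_less[of _ "{x, y}" "{z, w}" _ "{y, w}"])
        (auto simp: H'_def doubleton_eq_iff)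
    ultimately show ?thesis by blast
  qed
  have self: "{v} \<notin> G" "{v} \<notin> H" for v
    using simple_graph_edgeD(3)[OF G, of v v] simple_graph_edgeD(3)[OF H, of v v] by auto
  \<comment> \<open>For \<open>w\<close> in \<open>R y\<close> other than \<open>z\<close>,
    \<open>1\<close> shows that \<open>zw\<close> lies in \<open>G\<close> and \<open>2\<close> that
    it is not in \<open>H\<close>. The surplus is \<open>x\<close>, which is not in
    \<open>R y\<close>.\<close>
  have "card (R y) < card (R z)"
  proof (rule card_less_by_exchange)
    show "R y - {z} \<subseteq> R z - {x, y}"
    proof
      fix w assume w: "w \<in> R y - {z}"
      then have "{y, w} \<in> G" "{y, w} \<notin> H" by (simp_all add: R_def mem_nbrs)
      moreover from this have "w \<noteq> x" "w \<noteq> y" using xy self by (auto simp: insert_commute)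
      ultimately show "w \<in> R z - {x, y}"
        using 1[of w] 2[of w] w by (auto simp: R_def mem_nbrs)
    qed
    show "x \<in> R z" using xz by (simp add: R_def mem_nbrs insert_commute)
    show "z \<in> R y \<longleftrightarrow> y \<in> R z" unfolding R_def by (rule nbrs_sym)
  qed (use fin xyV in auto)
  moreover have "card (B z) < card (B y)"
  proof (rule card_less_by_exchange)
    show "B z - {y} \<subseteq> B y - {x, z}"
    proof
      fix w assume w: "w \<in> B z - {y}"
      then have "{z, w} \<in> H" "{z, w} \<notin> G" by (simp_all add: B_def mem_nbrs)
      moreover from this have "w \<noteq> x" "w \<noteq> z" using xz self by (auto simp: insert_commute)
      ultimately show "w \<in> B y - {x, z}"
        using 1[of w] 2[of w] w by (auto simp: B_def mem_nbrs)
    qed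
    show "x \<in> B y" using xy by (simp add: B_def mem_nbrs insert_commute)
    show "y \<in> B z \<longleftrightarrow> z \<in> B y" unfolding B_def by (rule nbrs_sym)
  qed (use fin xzV in auto)
  ultimately show False using RB[OF xyV(2)] RB[OF xzV(2)] by simp
qed

text \<open>Each step keeps both degree functions, hence also the degree hypothesis, so the descent
  ends only with \<open>H\<close> inside \<open>G\<close>.\<close>

theorem kundu:
  assumes "simple_graph V G" "simple_graph V H"
    and "\<And>v. v \<in> V \<Longrightarrow> degree G v = degree H v + k"
  obtains G' where "simple_graph V G'" "\<And>v. degree G' v = degree G v" "has_factor k V G'"
proof -
  have "\<exists>G' H'. simple_graph V G' \<and> H' \<subseteq> G' \<and>
      (\<forall>v. degree G' v = degree G v) \<and> (\<forall>v. degree H' v = degree H v)"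
    using assms
  proof (induction "card (H - G)" arbitrary: G H rule: less_induct)
    case less
    show ?case
    proof (cases "H \<subseteq> G")
      case True
      then show ?thesis using less.prems by blast
    next
      case False
      with less.prems obtain G' H' where GH: "simple_graph V G'" "simple_graph V H'"
        and deg: "\<And>v. degree G' v = degree G v" "\<And>v. degree H' v = degree H v"
        and "card (H' - G') < card (H - G)"
        using kundu_step[of V G H k] by metis
      from less.hyps[OF this(5) GH] less.prems(3) show ?thesis by (simp add: deg)
    qed
  qed
  then obtain G' H' where G': "simple_graph V G'" and sub: "H' \<subseteq> G'"
    and deg: "\<And>v. degree G' v = degree G v" "\<And>v. degree H' v = degree H v"
    by blast
  have "degree (G' - H') v = k" if "v \<in> V" for v
    using degree_diff[OF simple_graph_finite_edges[OF G'], of v H'] sub assms(3)[OF that] deg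
    by (simp add: Int_absorb1)
  moreover have "simple_graph V (G' - H')" using G' by (rule simple_graph_mono) auto
  ultimately have "has_factor k V G'"
    by (auto simp: has_factor_def subgraph_def regular_def)
  with G' deg(1) show thesis by (rule that)
qed

section \<open>The Erdos--Gallai theorem\<close>

text \<open>Each neighbourhood splits into its parts inside and outside \<open>A\<close>; edges
  leaving \<open>A\<close> are then counted from their outer ends.\<close>

lemma sum_degree_split:
  assumes E: "simple_graph V E" and A: "A \<subseteq> V"
  shows "(\<Sum>v\<in>A. degree E v) =
    (\<Sum>v\<in>A. card (nbrs E v \<inter> A)) + (\<Sum>v\<in>V - A. card (nbrs E v \<inter> A))"
proof -
  have fin: "finite V" "finite A" using E A finite_subset by (auto simp: simple_graph_def)
  have "degree E v = card (nbrs E v \<inter> A) + card (nbrs E v \<inter> (V - A))" for v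
  proof -
    have "nbrs E v = (nbrs E v \<inter> A) \<union> (nbrs E v \<inter> (V - A))"
      using nbrs_subset[OF E] by auto
    then have "card (nbrs E v) = card ((nbrs E v \<inter> A) \<union> (nbrs E v \<inter> (V - A)))" by simp
    also have "\<dots> = card (nbrs E v \<inter> A) + card (nbrs E v \<inter> (V - A))"
      using finite_nbrs[OF E] by (intro card_Un_disjoint) auto
    finally show ?thesis by (simp add: degree_eq_card_nbrs[OF E])
  qed
  then show ?thesis
    using fin by (simp add: sum.distrib sum_card_nbrs_swap[of A "V - A"])
qed

text \<open>Without loops a vertex of \<open>A\<close> has at most \<open>card A - 1\<close>
  neighbours in \<open>A\<close>; an outer vertex has at most \<open>card A\<close> there and at
  most its degree.\<close>

lemma erdos_gallai_necessary:
  assumes E: "simple_graph V E" and A: "A \<subseteq> V"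
  shows "(\<Sum>v\<in>A. degree E v) \<le>
    card A * (card A - 1) + (\<Sum>v\<in>V - A. min (card A) (degree E v))"
proof -
  have fin: "finite A" using E A finite_subset by (auto simp: simple_graph_def)
  have "card (nbrs E v \<inter> A) \<le> card A - 1" if "v \<in> A" for v
  proof -
    have "card (nbrs E v \<inter> A) \<le> card (A - {v})"
      using fin nbrs_subset[OF E, of v] by (intro card_mono) auto
    then show ?thesis using that fin by simp
  qed
  then have "(\<Sum>v\<in>A. card (nbrs E v \<inter> A)) \<le> (\<Sum>v\<in>A. card A - 1)" by (intro sum_mono)
  moreover have "(\<Sum>v\<in>V - A. card (nbrs E v \<inter> A)) \<le> (\<Sum>v\<in>V - A. min (card A) (degree E v))"
    using fin finite_nbrs[OF E] by (intro sum_mono) (auto simp: degree_eq_card_nbrs[OF E] intro: card_mono)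
  ultimately show ?thesis using sum_degree_split[OF E A] by simp
qed

text \<open>Otherwise all neighbours of \<open>i\<close> except \<open>r\<close> are neighbours of
  \<open>r\<close>. If \<open>i\<close> and \<open>r\<close> are adjacent, each is deleted from the
  other's neighbourhood before comparing sizes.\<close>

lemma ex_private_nbr:
  assumes E: "simple_graph V E" and lt: "degree E r < degree E i"
  obtains u where "{i, u} \<in> E" "{r, u} \<notin> E" "u \<noteq> r"
proof (rule ccontr)
  assume "\<not> thesis"
  then have sub: "nbrs E i - {r} \<subseteq> nbrs E r" using that unfolding nbrs_def by blast
  note fin = finite_nbrs[OF E] and deg = degree_eq_card_nbrs[OF E]
  have irr: "i \<notin> nbrs E i" using nbrs_subset[OF E] by auto
  show False
  proof (cases "r \<in> nbrs E i")
    case True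
    then have "i \<in> nbrs E r" using nbrs_sym by metis
    moreover have "card (nbrs E i - {r}) \<le> card (nbrs E r - {i})"
      using sub irr fin by (intro card_mono) auto
    ultimately have "card (nbrs E i) - 1 \<le> card (nbrs E r) - 1" "card (nbrs E r) > 0"
      using True fin by (auto simp: card_gt_0_iff)
    then show False using lt deg by simp
  next
    case False
    then have "card (nbrs E i) \<le> card (nbrs E r)" using sub fin by (intro card_mono) auto
    then show False using lt deg by simp
  qed
qed

text \<open>At \<open>i\<close> the neighbour \<open>u\<close> is replaced by \<open>p\<close>, and
  \<open>u\<close> gets \<open>r\<close> in return, so only \<open>r\<close> and \<open>p\<close>
  gain. The increments are separate summands because \<open>p = r\<close> is allowed and then gains
  two.\<close>

lemma shift_edge:
  assumes E: "simple_graph V E" and edges: "{i, u} \<in> E" "{r, u} \<notin> E" "{i, p} \<notin> E"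
    and "u \<noteq> r" "i \<noteq> p" "i \<noteq> r" "r \<in> V" "p \<in> V"
  defines "E' \<equiv> insert {r, u} (insert {i, p} (E - {{i, u}}))"
  shows "simple_graph V E'"
    and "degree E' v = degree E v + (if v = r then 1 else 0) + (if v = p then 1 else 0)"
proof -
  note iu = simple_graph_edgeD[OF E edges(1)] and fin = simple_graph_finite_edges[OF E]
  show "simple_graph V E'"
    unfolding E'_def using assms iu
    by (intro simple_graph_insert) (auto intro: simple_graph_mono)
  have "degree E v = degree (E - {{i, u}}) v + (if v \<in> {i, u} then 1 else 0)"
    using fin edges by (intro degree_remove) auto
  moreover have "degree (insert {i, p} (E - {{i, u}})) v =
      degree (E - {{i, u}}) v + (if v \<in> {i, p} then 1 else 0)"
    using fin edges by (intro degree_insert) auto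
  moreover have "degree E' v =
      degree (insert {i, p} (E - {{i, u}})) v + (if v \<in> {r, u} then 1 else 0)"
    unfolding E'_def using fin assms iu by (intro degree_insert) (auto simp: doubleton_eq_iff)
  moreover have "u \<noteq> p" using edges by auto
  ultimately show
    "degree E' v = degree E v + (if v = r then 1 else 0) + (if v = p then 1 else 0)"
    using iu assms(5-7) by auto
qed

text \<open>By the handshake lemma the total deficit is even, so a deficit of one at
  \<open>r\<close> is not the only one.\<close>

lemma even_deficit:
  fixes e :: "'a \<Rightarrow> nat"
  assumes E: "simple_graph V E" and "even (\<Sum>v\<in>V. e v)"
    and "r \<in> V" "degree E r + 1 = e r" and le: "\<And>v. v \<in> V \<Longrightarrow> degree E v \<le> e v"
  obtains k where "k \<in> V" "k \<noteq> r" "degree E k < e k"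
proof (rule ccontr)
  note witness = that
  assume "\<not> thesis"
  then have "degree E v = e v" if "v \<in> V - {r}" for v
    using that le[of v] witness[of v] by fastforce
  then have "(\<Sum>v\<in>V - {r}. degree E v) = (\<Sum>v\<in>V - {r}. e v)" by (intro sum.cong) auto
  moreover have "finite V" using E by (simp add: simple_graph_def)
  ultimately have "(\<Sum>v\<in>V. e v) = (\<Sum>v\<in>V. degree E v) + 1"
    using assms by (simp add: sum.remove[of V r])
  then show False using sum_degree[OF E] assms(2) by simp
qed

section \<open>Sufficiency by improving partial realizations\<close>

locale erdos_gallai_sequence =
  fixes n :: nat and e :: "nat \<Rightarrow> nat"
  assumes antimono: "antimono_on {1..n} e"
    and even_sum: "even (\<Sum>i\<in>{1..n}. e i)"
    and ineq: "\<And>r. r \<in> {1..n} \<Longrightarrow>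
      (\<Sum>i\<in>{1..r}. e i) \<le> r * (r - 1) + (\<Sum>i\<in>{1..n} - {1..r}. min r (e i))"
begin

definition partial_realization :: "nat \<Rightarrow> nat set set \<Rightarrow> bool" where
  "partial_realization r E \<longleftrightarrow> simple_graph {1..n} E \<and>
    (\<forall>i\<in>{1..n}. degree E i \<le> e i) \<and> (\<forall>i\<in>{1..<r}. degree E i = e i)"

text \<open>If nothing improves \<open>r\<close>, then \<open>{1..r}\<close> is a clique and every
  later \<open>k\<close> has exactly \<open>min r (e k)\<close> neighbours in it. The degrees up to
  \<open>r\<close> then sum to the right-hand side of \<open>ineq\<close>, yet to less than the
  left-hand side.\<close>

lemma improve_independent:
  assumes part: "partial_realization r E" and r: "r \<in> {1..n}" and lt: "degree E r < e r"
    and indep: "\<And>i j. i > r \<Longrightarrow> j > r \<Longrightarrow> {i, j} \<notin> E"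
  shows "\<exists>E'. partial_realization r E' \<and> degree E r < degree E' r"
proof (rule ccontr)
  assume no: "\<not> ?thesis"
  have E: "simple_graph {1..n} E" and le: "\<And>i. i \<in> {1..n} \<Longrightarrow> degree E i \<le> e i"
    and eq: "\<And>i. i \<in> {1..<r} \<Longrightarrow> degree E i = e i"
    using part by (auto simp: partial_realization_def)
  note fin = simple_graph_finite_edges[OF E]
  have improve: "\<not> degree E r < degree E' r"
    if "simple_graph {1..n} E'" "\<And>i. i \<in> {1..n} \<Longrightarrow> degree E' i \<le> e i"
      "\<And>i. i \<in> {1..<r} \<Longrightarrow> degree E' i = e i" for E'
    using no that by (auto simp: partial_realization_def)
  have private_nbr: "\<exists>u. {i, u} \<in> E \<and> {r, u} \<notin> E \<and> u \<noteq> r" if "i \<in> {1..<r}" for i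
  proof -
    have "e r \<le> e i" using antimono that r by (auto simp: monotone_on_def)
    then have "degree E r < degree E i" using lt eq[OF that] by simp
    then show ?thesis using ex_private_nbr[OF E] by metis
  qed
  \<comment> \<open>Otherwise the edge \<open>rk\<close> could simply be added.\<close>
  have deficient: "{r, k} \<in> E" if k: "k \<in> {r<..n}" "degree E k < e k" for k
  proof (rule ccontr)
    assume "{r, k} \<notin> E"
    then have deg: "degree (insert {r, k} E) v = degree E v + (if v \<in> {r, k} then 1 else 0)" for v
      using fin by (intro degree_insert)
    show False
    proof (rule improve[THEN notE])
      show "simple_graph {1..n} (insert {r, k} E)" using E k r by (intro simple_graph_insert) auto
      show "degree (insert {r, k} E) i \<le> e i" if "i \<in> {1..n}" for i
        using le[OF that] lt k unfolding deg by auto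
      show "degree (insert {r, k} E) i = e i" if "i \<in> {1..<r}" for i
        using eq[OF that] that k unfolding deg by auto
    qed (simp add: deg)
  qed
  \<comment> \<open>Otherwise \<open>shift_edge\<close> with \<open>p = r\<close> raises the degree
    of \<open>r\<close> by two.\<close>
  have low: "{i, r} \<in> E" if i: "i \<in> {1..<r}" for i
  proof (rule ccontr)
    assume nir: "{i, r} \<notin> E"
    obtain u where u: "{i, u} \<in> E" "{r, u} \<notin> E" "u \<noteq> r" using private_nbr[OF i] by blast
    define E1 where "E1 = insert {r, u} (insert {i, r} (E - {{i, u}}))"
    have E1: "simple_graph {1..n} E1" and
      deg: "\<And>v. degree E1 v = degree E v + (if v = r then 1 else 0) + (if v = r then 1 else 0)"
      unfolding E1_def by (rule shift_edge[OF E]; use u nir i r in auto)+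
    show False
    proof (cases "degree E r + 2 \<le> e r")
      case True
      show False
      proof (rule improve[THEN notE, OF E1])
        show "degree E1 j \<le> e j" if "j \<in> {1..n}" for j using le[OF that] True by (simp add: deg)
        show "degree E1 j = e j" if "j \<in> {1..<r}" for j using eq[OF that] that by (simp add: deg)
      qed (simp add: deg)
    next
      case False
      \<comment> \<open>Gaining two would overshoot. Parity yields another deficient
        \<open>k\<close>, which lies beyond \<open>r\<close> and is adjacent to \<open>r\<close>;
        deleting \<open>rk\<close> removes the surplus, and \<open>k\<close> may lose an
        edge.\<close>
      with lt have "degree E r + 1 = e r" by simp
      then obtain k where k: "k \<in> {1..n}" "k \<noteq> r" "degree E k < e k"
        using even_deficit[OF E even_sum r _ le] by blast
      then have kr: "k \<in> {r<..n}" using eq[of k] by force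
      with k have "{r, k} \<in> E" using deficient by blast
      moreover have "{r, k} \<noteq> {i, u}" using u i by (auto simp: doubleton_eq_iff)
      ultimately have "{r, k} \<in> E1" by (simp add: E1_def)
      from degree_remove[OF simple_graph_finite_edges[OF E1] this]
      have deg2: "degree E1 v = degree (E1 - {{r, k}}) v + (if v \<in> {r, k} then 1 else 0)" for v .
      show False
      proof (rule improve[THEN notE])
        show "simple_graph {1..n} (E1 - {{r, k}})" using E1 by (rule simple_graph_mono) auto
        show "degree (E1 - {{r, k}}) j \<le> e j" if "j \<in> {1..n}" for j
          using le[OF that] lt deg[of j] deg2[of j] by (auto split: if_splits)
        show "degree (E1 - {{r, k}}) j = e j" if "j \<in> {1..<r}" for j
          using eq[OF that] that kr deg[of j] deg2[of j] by auto
        show "degree E r < degree (E1 - {{r, k}}) r" using deg[of r] deg2[of r] by simp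
      qed
    qed
  qed
  have nbrs_high: "nbrs E k \<subseteq> {1..r}" if "k \<in> {r<..n}" for k
  proof
    fix w assume "w \<in> nbrs E k"
    then have "{k, w} \<in> E" by (simp add: mem_nbrs)
    then show "w \<in> {1..r}"
      using indep[of k w] that simple_graph_edgeD(2)[OF E, of k w] by (cases "w > r") auto
  qed
  \<comment> \<open>Otherwise some \<open>i\<close> up to \<open>r\<close> misses \<open>k\<close>,
    and \<open>i\<close> is not \<open>r\<close> by \<open>deficient\<close>. Giving a private
    neighbour of \<open>i\<close> to \<open>r\<close> and \<open>k\<close> to \<open>i\<close>
    raises \<open>r\<close> and \<open>k\<close> by one each.\<close>
  have high: "degree E k = min r (e k)" if k: "k \<in> {r<..n}" for k
  proof (rule ccontr)
    assume neq: "degree E k \<noteq> min r (e k)"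
    have "degree E k \<le> r"
      using card_mono[OF _ nbrs_high[OF k]] by (simp add: degree_eq_card_nbrs[OF E])
    then have ltk: "degree E k < r" "degree E k < e k" using neq le[of k] k by auto
    have "\<not> {1..r} \<subseteq> nbrs E k"
      using card_mono[OF finite_nbrs[OF E], of "{1..r}" k] ltk by (auto simp: degree_eq_card_nbrs[OF E])
    then obtain i where "i \<in> {1..r}" "i \<notin> nbrs E k" by blast
    then have i: "i \<in> {1..r}" "{i, k} \<notin> E" by (simp_all add: mem_nbrs insert_commute)
    then have ir: "i \<in> {1..<r}" using deficient[OF k ltk(2)] by (cases "i = r") auto
    obtain u where u: "{i, u} \<in> E" "{r, u} \<notin> E" "u \<noteq> r" using private_nbr[OF ir] by blast
    define E1 where "E1 = insert {r, u} (insert {i, k} (E - {{i, u}}))"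
    have E1: "simple_graph {1..n} E1" and
      deg: "\<And>v. degree E1 v = degree E v + (if v = r then 1 else 0) + (if v = k then 1 else 0)"
      unfolding E1_def by (rule shift_edge[OF E]; use u i ir r k in auto)+
    show False
    proof (rule improve[THEN notE, OF E1])
      show "degree E1 j \<le> e j" if "j \<in> {1..n}" for j
        using le[OF that] lt ltk k by (simp add: deg)
      show "degree E1 j = e j" if "j \<in> {1..<r}" for j
        using eq[OF that] that k by (simp add: deg)
    qed (simp add: deg)
  qed
  \<comment> \<open>Otherwise \<open>iu\<close> is replaced by \<open>ru\<close> and
    \<open>ij\<close>, and the surplus at \<open>j\<close> is removed with \<open>jw\<close>. By
    \<open>low\<close>, \<open>w\<close> lies beyond \<open>r\<close> and may lose an edge.\<close>
  have clique: "{i, j} \<in> E" if ij: "i \<in> {1..<r}" "j \<in> {1..<r}" "i \<noteq> j" for i j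
  proof (rule ccontr)
    assume nij: "{i, j} \<notin> E"
    obtain u where u: "{i, u} \<in> E" "{r, u} \<notin> E" "u \<noteq> r" using private_nbr[OF ij(1)] by blast
    obtain w where w: "{j, w} \<in> E" "{r, w} \<notin> E" "w \<noteq> r" using private_nbr[OF ij(2)] by blast
    have wr: "w > r"
      using low[of w] w simple_graph_edgeD(2)[OF E w(1)] by (force simp: insert_commute)
    have ju: "j \<noteq> u" using low[OF ij(2)] u by (auto simp: insert_commute)
    define E1 where "E1 = insert {r, u} (insert {i, j} (E - {{i, u}}))"
    have E1: "simple_graph {1..n} E1" and
      deg: "\<And>v. degree E1 v = degree E v + (if v = r then 1 else 0) + (if v = j then 1 else 0)"
      unfolding E1_def by (rule shift_edge[OF E]; use u nij ij r in auto)+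
    have "{j, w} \<in> E1" using w ij ju by (auto simp: E1_def doubleton_eq_iff)
    from degree_remove[OF simple_graph_finite_edges[OF E1] this]
    have deg2: "degree E1 v = degree (E1 - {{j, w}}) v + (if v \<in> {j, w} then 1 else 0)" for v .
    show False
    proof (rule improve[THEN notE])
      show "simple_graph {1..n} (E1 - {{j, w}})" using E1 by (rule simple_graph_mono) auto
      show "degree (E1 - {{j, w}}) v \<le> e v" if "v \<in> {1..n}" for v
        using le[OF that] lt deg[of v] deg2[of v] by (auto split: if_splits)
      show "degree (E1 - {{j, w}}) v = e v" if "v \<in> {1..<r}" for v
        using eq[OF that] that wr deg[of v] deg2[of v] by (auto split: if_splits)
      show "degree E r < degree (E1 - {{j, w}}) r" using deg[of r] deg2[of r] ij wr by auto
    qed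
  qed
  have "nbrs E i \<inter> {1..r} = {1..r} - {i}" if "i \<in> {1..r}" for i
  proof
    show "nbrs E i \<inter> {1..r} \<subseteq> {1..r} - {i}" using nbrs_subset[OF E] by auto
    show "{1..r} - {i} \<subseteq> nbrs E i \<inter> {1..r}"
    proof
      fix j assume j: "j \<in> {1..r} - {i}"
      then have "{i, j} \<in> E"
        using that low[of i] low[of j] clique[of i j]
        by (cases "i = r"; cases "j = r") (auto simp: insert_commute)
      then show "j \<in> nbrs E i \<inter> {1..r}" using j by (simp add: mem_nbrs)
    qed
  qed
  then have "(\<Sum>i\<in>{1..r}. card (nbrs E i \<inter> {1..r})) = r * (r - 1)" by simp
  moreover have "card (nbrs E k \<inter> {1..r}) = min r (e k)" if "k \<in> {1..n} - {1..r}" for k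
  proof -
    have k: "k \<in> {r<..n}" using that by auto
    then have "nbrs E k \<inter> {1..r} = nbrs E k" using nbrs_high by blast
    then show ?thesis using high[OF k] by (simp add: degree_eq_card_nbrs[OF E])
  qed
  then have "(\<Sum>k\<in>{1..n} - {1..r}. card (nbrs E k \<inter> {1..r})) =
      (\<Sum>k\<in>{1..n} - {1..r}. min r (e k))"
    by (intro sum.cong) auto
  \<comment> \<open>Both estimates behind \<open>erdos_gallai_necessary\<close> are now
    equalities.\<close>
  ultimately have "(\<Sum>i\<in>{1..r}. degree E i) = r * (r - 1) + (\<Sum>k\<in>{1..n} - {1..r}. min r (e k))"
    using sum_degree_split[OF E, of "{1..r}"] r by auto
  moreover have "(\<Sum>i\<in>{1..r}. degree E i) < (\<Sum>i\<in>{1..r}. e i)"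
    using le lt r by (intro sum_strict_mono_ex1) auto
  ultimately show False using ineq[OF r] by simp
qed

text \<open>Edges beyond \<open>r\<close> may be discarded, since no progress at later vertices has to be kept.\<close>

lemma improve:
  assumes part: "partial_realization r E" and r: "r \<in> {1..n}" and lt: "degree E r < e r"
  shows "\<exists>E'. partial_realization r E' \<and> degree E r < degree E' r"
proof -
  define F where "F = {f \<in> E. \<not> f \<subseteq> {r<..}}"
  have E: "simple_graph {1..n} E" using part by (simp add: partial_realization_def)
  have sub: "F \<subseteq> E" by (auto simp: F_def)
  have same: "degree F i = degree E i" if "i \<le> r" for i
    unfolding degree_def F_def using that by (intro arg_cong[where f = card]) auto
  have "degree F i \<le> e i" if "i \<in> {1..n}" for i
    using degree_mono[OF simple_graph_finite_edges[OF E] sub, of i] part that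
    by (auto simp: partial_realization_def intro: order_trans)
  then have "partial_realization r F"
    using part same simple_graph_mono[OF E sub] by (auto simp: partial_realization_def)
  moreover have "{i, j} \<notin> F" if "i > r" "j > r" for i j using that by (auto simp: F_def)
  ultimately show ?thesis
    using improve_independent[of r F] r lt same[of r] by simp
qed

text \<open>Starting from the empty graph, vertices are saturated in order: a partial realization of
  maximal degree at the next vertex must saturate it, by \<open>improve\<close>. For
  \<open>r = n\<close> all vertices are saturated.\<close>

lemma ex_partial_realization: "r \<le> n \<Longrightarrow> \<exists>E. partial_realization (Suc r) E"
proof (induction r)
  case 0
  have "partial_realization (Suc 0) {}"
    by (simp add: partial_realization_def simple_graph_def degree_def)
  then show ?case by blast
next
  case (Suc r)
  then obtain E0 where E0: "partial_realization (Suc r) E0" by auto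
  have r: "Suc r \<in> {1..n}" using Suc.prems by simp
  have bound: "degree E (Suc r) \<le> e (Suc r)" if "partial_realization (Suc r) E" for E
    using that r by (simp add: partial_realization_def)
  then obtain E where E: "partial_realization (Suc r) E"
    and max: "\<And>E'. partial_realization (Suc r) E' \<Longrightarrow> degree E' (Suc r) \<le> degree E (Suc r)"
    using ex_has_greatest_nat[of "partial_realization (Suc r)" E0 "\<lambda>E. degree E (Suc r)" "e (Suc r) + 1"] E0
    by (metis add.commute le_imp_less_Suc plus_1_eq_Suc)
  have "degree E (Suc r) = e (Suc r)"
    using improve[OF E r] max bound[OF E] by (meson leD le_neq_implies_less)
  with E have "partial_realization (Suc (Suc r)) E"
    by (auto simp: partial_realization_def less_Suc_eq)
  then show ?case by blast
qed

theorem erdos_gallai: "graphic n e"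
  using ex_partial_realization[of n] unfolding graphic_iff partial_realization_def by fastforce

end

section \<open>Lowering a graphic sequence by a constant\<close>

text \<open>Here \<open>e\<close> is \<open>d\<close> lowered by \<open>k\<close>, and
  \<open>m\<close> is \<open>d 1 - d n\<close>. The hypothesis \<open>mid\<close> is the one on
  \<open>d\<close> at index \<open>m + 1\<close>, \<open>room\<close> comes from
  \<open>d 1 < n\<close>, and \<open>raised\<close> is the inequality for \<open>d\<close>.\<close>

lemma lowered_inequality:
  fixes e :: "nat \<Rightarrow> nat"
  assumes anti: "antimono_on {1..n} e"
    and even: "even (\<Sum>i\<in>{1..n}. e i)"
    and high: "\<And>i. i \<in> {1..n} \<Longrightarrow> e i \<le> e n + m"
    and mid: "m \<le> e (m + 1) + 1"
    and room: "e n + m + 1 \<le> n"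
    and raised: "(\<Sum>i\<in>{1..t}. e i + k) \<le> t * (t - 1) + (\<Sum>i\<in>{1..n} - {1..t}. min t (e i + k))"
    and t: "t \<in> {1..n}"
  shows "(\<Sum>i\<in>{1..t}. e i) \<le> t * (t - 1) + (\<Sum>i\<in>{1..n} - {1..t}. min t (e i))"
proof -
  have mono: "e j \<le> e i" if "i \<in> {1..n}" "j \<in> {1..n}" "i \<le> j" for i j
    using monotone_onD[OF anti that] .
  have n: "n \<in> {1..n}" using room by simp
  have tail: "{1..n} - {1..t} = {t<..n}" by auto
  define A where "A = (\<Sum>i\<in>{1..t}. e i)"
  define S where "S = (\<Sum>i\<in>{t<..n}. min t (e i))"
  define S' where "S' = (\<Sum>i\<in>{t<..n}. min t (e i + k))"
  have bound1: "A \<le> t * (e n + m)"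
    using sum_bounded_above[of "{1..t}" e "e n + m"] high t by (simp add: A_def)
  \<comment> \<open>Lowering gains \<open>k * t\<close> on the left, which pays for the loss on the
    right if at most \<open>t\<close> entries there drop, each by at most \<open>k\<close>.\<close>
  have bound2: "A + k * t \<le> t * (t - 1) + S'"
    using raised unfolding tail by (simp add: A_def S'_def sum.distrib mult.commute)
  have low: "e n \<le> e i" if "i \<in> {1..n}" for i using mono[OF that n] that by simp
  \<comment> \<open>In the last case \<open>t = m\<close> and \<open>e (m + 1) = m - 1\<close>.\<close>
  consider "t \<le> e n" | "e n < t" "m + 1 \<le> t" | "e n < t" "t \<le> m" "t \<le> e (m + 1)"
    | "e n < t" "t \<le> m" "e (m + 1) < t" by linarith
  then have "A \<le> t * (t - 1) + S"
  proof cases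
    case 1
    \<comment> \<open>All later entries are cut off at \<open>t\<close>, so \<open>room\<close>
      alone suffices.\<close>
    have "t \<le> e i" if "i \<in> {t<..n}" for i using low[of i] 1 that by simp
    then have "S = (\<Sum>i\<in>{t<..n}. t)" unfolding S_def by (intro sum.cong) auto
    then have "S = (n - t) * t" by simp
    moreover have "A \<le> t * (n - 1)"
      using bound1 room by (meson add_le_imp_le_diff le_trans mult_le_mono2)
    moreover obtain q where "n = t + q" using t by (auto dest: le_Suc_ex)
    moreover obtain s where "t = Suc s" using t by (cases t) auto
    ultimately show ?thesis by (simp add: algebra_simps)
  next
    case 2
    obtain q where q: "n = t + q" using t by (auto dest: le_Suc_ex)
    show ?thesis
    proof (cases "t \<le> q")
      case True
      have "q * e n \<le> S"
        using sum_bounded_below[of "{t<..n}" "e n" "\<lambda>i. min t (e i)"] low 2 t q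
        by (auto simp: S_def)
      moreover have "t * e n \<le> q * e n" using True by simp
      moreover have "t * m \<le> t * (t - 1)" using 2 by simp
      ultimately show ?thesis using bound1 unfolding distrib_left by linarith
    next
      case False
      have "S' \<le> (\<Sum>i\<in>{t<..n}. min t (e i) + k)" unfolding S'_def by (intro sum_mono) auto
      then have "S' \<le> S + k * q" by (simp add: S_def sum.distrib q mult.commute)
      moreover have "k * q \<le> k * t" using False by simp
      ultimately show ?thesis using bound2 by linarith
    qed
  next
    case 3
    obtain q where q: "n = m + 1 + q" using room by (metis add.assoc le_Suc_ex add.commute trans_le_add2)
    obtain p where p: "m = t + p" using 3 by (auto dest: le_Suc_ex)
    have split: "{t<..n} = {t<..m + 1} \<union> {m + 1<..n}" "{t<..m + 1} \<inter> {m + 1<..n} = {}"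
      using 3 q by auto
    \<comment> \<open>Indices up to \<open>m + 1\<close> contribute exactly \<open>t\<close> to both
      \<open>S\<close> and \<open>S'\<close>, so only the \<open>q\<close> later ones can lose by
      lowering.\<close>
    have full: "t \<le> e i" if "i \<in> {t<..m + 1}" for i
      using mono[of i "m + 1"] that 3 q by force
    have "(\<Sum>i\<in>{t<..m + 1}. min t (e i)) = (\<Sum>i\<in>{t<..m + 1}. t)"
      using full by (intro sum.cong) auto
    moreover have "(\<Sum>i\<in>{t<..m + 1}. min t (e i + k)) = (\<Sum>i\<in>{t<..m + 1}. t)"
      using full by (intro sum.cong) (auto simp: min_def trans_le_add1)
    ultimately have S: "S = (p + 1) * t + (\<Sum>i\<in>{m + 1<..n}. min t (e i))"
      and S': "S' = (p + 1) * t + (\<Sum>i\<in>{m + 1<..n}. min t (e i + k))"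
      unfolding S_def S'_def split(1) by (simp_all add: sum.union_disjoint split(2) p)
    show ?thesis
    proof (cases "t \<le> q")
      case True
      have "q * e n \<le> (\<Sum>i\<in>{m + 1<..n}. min t (e i))"
        using sum_bounded_below[of "{m + 1<..n}" "e n" "\<lambda>i. min t (e i)"] low 3 q by auto
      moreover have "t * e n \<le> q * e n" using True by simp
      moreover have "t * m = t * (t - 1) + (p + 1) * t"
        using t p by (cases t) (auto simp: algebra_simps)
      ultimately show ?thesis using bound1 S unfolding distrib_left by linarith
    next
      case False
      have "(\<Sum>i\<in>{m + 1<..n}. min t (e i + k)) \<le> (\<Sum>i\<in>{m + 1<..n}. min t (e i) + k)"
        by (intro sum_mono) auto
      then have "S' \<le> S + k * q" by (simp add: S S' sum.distrib q mult.commute)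
      moreover have "k * q \<le> k * t" using False by simp
      ultimately show ?thesis using bound2 by linarith
    qed
  next
    case 4
    then have tm: "t = m" and em: "e (m + 1) + 1 = m" using mid by auto
    obtain q where q: "n = m + 1 + q" using room by (metis add.assoc le_Suc_ex add.commute trans_le_add2)
    have split: "{t<..n} = insert (m + 1) {m + 1<..n}" using q tm by auto
    have "e i \<le> t" if "i \<in> {t<..n}" for i
      using mono[of "m + 1" i] that tm em q by force
    then have Seq: "S = (\<Sum>i\<in>{t<..n}. e i)" unfolding S_def by (intro sum.cong) auto
    have "{1..n} = {1..t} \<union> {t<..n}" using t by auto
    then have "(\<Sum>i\<in>{1..n}. e i) = A + S"
      by (simp add: A_def Seq sum.union_disjoint[symmetric] ivl_disj_int)
    then have parity: "even (A + S)" using even by simp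
    \<comment> \<open>Index \<open>m + 1\<close> contributes \<open>m - 1\<close> instead of
      \<open>m\<close>; this is why both bounds miss by one.\<close>
    have S: "S + 1 = m + (\<Sum>i\<in>{m + 1<..n}. e i)" unfolding Seq split using em by simp
    have "A \<le> t * (t - 1) + S + 1"
    proof (cases "t \<le> q")
      case True
      have "q * e n \<le> (\<Sum>i\<in>{m + 1<..n}. e i)"
        using sum_bounded_below[of "{m + 1<..n}" "e n" e] low q by auto
      moreover have "t * e n \<le> q * e n" using True by simp
      moreover have "t * m = t * (t - 1) + m" using tm em by (cases m) auto
      ultimately show ?thesis using bound1 S unfolding distrib_left by linarith
    next
      case False
      have "S' \<le> m + (\<Sum>i\<in>{m + 1<..n}. e i + k)"
        unfolding S'_def split using tm by (simp add: add_mono sum_mono)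
      then have "S' \<le> S + 1 + k * q" using S by (simp add: sum.distrib q mult.commute)
      moreover have "k * q \<le> k * t" using False by simp
      ultimately show ?thesis using bound2 by linarith
    qed
    \<comment> \<open>Equality would make \<open>A + S\<close> odd, so the bound improves by
      one.\<close>
    moreover have "even (t * (t - 1))" by auto
    with parity have "A \<noteq> t * (t - 1) + S + 1" by presburger
    ultimately show ?thesis by linarith
  qed
  then show ?thesis by (simp only: A_def S_def tail)
qed

theorem theorem5:
  fixes n k :: nat and d :: "nat \<Rightarrow> nat"
  assumes "n \<ge> 1"
    and "antimono_on {1..n} d"
    and "graphic n d"
    and "k \<le> d n"
    and "even (k * n)"
    and "int (d (d 1 - d n + 1)) \<ge> int (d 1) - int (d n) + int k - 1"
  shows "\<exists>(V :: nat set) E. realization n d V E \<and> has_factor k V E"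
proof -
  obtain G where G: "simple_graph {1..n} G" and degG: "\<And>i. i \<in> {1..n} \<Longrightarrow> degree G i = d i"
    using \<open>graphic n d\<close> graphic_iff by blast
  \<comment> \<open>The subtraction never truncates on \<open>{1..n}\<close>, since
    \<open>d n\<close> is the least entry.\<close>
  define e where "e i = d i - k" for i
  define m where "m = d 1 - d n"
  have mono: "d j \<le> d i" if "i \<in> {1..n}" "j \<in> {1..n}" "i \<le> j" for i j
    using monotone_onD[OF assms(2) that] .
  have kd: "k \<le> d i" if "i \<in> {1..n}" for i
    using mono[OF that, of n] that assms(4) by simp
  have de: "d i = e i + k" if "i \<in> {1..n}" for i using kd[OF that] by (simp add: e_def)
  have dn: "d n \<le> d 1" using mono[of 1 n] assms(1) by simp
  \<comment> \<open>Vertex 1 has at most \<open>n - 1\<close> neighbours, so \<open>m + 1\<close> is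
    a genuine index.\<close>
  have "d 1 = card (nbrs G 1)" using degG[of 1] assms(1) degree_eq_card_nbrs[OF G] by simp
  also have "\<dots> \<le> card ({1..n} - {1})" by (intro card_mono nbrs_subset[OF G]) simp
  finally have "d 1 + 1 \<le> n" using assms(1) by simp
  then have room: "e n + m + 1 \<le> n" and m1: "m + 1 \<in> {1..n}"
    using dn by (auto simp: e_def m_def)
  interpret erdos_gallai_sequence n e
  proof
    show anti: "antimono_on {1..n} e"
      by (rule monotone_onI) (use mono in \<open>auto simp: e_def diff_le_mono\<close>)
    \<comment> \<open>The evenness of \<open>k * n\<close> carries parity from \<open>d\<close> over
      to \<open>e\<close>.\<close>
    have "(\<Sum>i\<in>{1..n}. d i) = (\<Sum>i\<in>{1..n}. e i) + k * n"
      using de by (simp add: sum.distrib mult.commute)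
    moreover have "(\<Sum>i\<in>{1..n}. d i) = 2 * card G"
      using sum_degree[OF G] degG by simp
    ultimately show ev: "even (\<Sum>i\<in>{1..n}. e i)"
      using assms(5) by (metis dvd_triv_left even_add)
    show "(\<Sum>i\<in>{1..r}. e i) \<le> r * (r - 1) + (\<Sum>i\<in>{1..n} - {1..r}. min r (e i))"
      if r: "r \<in> {1..n}" for r
    proof (rule lowered_inequality[OF anti ev _ _ room _ r])
      show "e i \<le> e n + m" if "i \<in> {1..n}" for i
        using mono[of 1 i] that assms(4) dn by (simp add: e_def m_def)
      show "m \<le> e (m + 1) + 1"
        using assms(6) dn kd[OF m1] by (simp add: e_def m_def)
      have "(\<Sum>i\<in>{1..r}. e i + k) = (\<Sum>i\<in>{1..r}. degree G i)"
        using r by (intro sum.cong) (auto simp: degG de)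
      moreover have "(\<Sum>i\<in>{1..n} - {1..r}. min r (e i + k)) =
          (\<Sum>i\<in>{1..n} - {1..r}. min r (degree G i))"
        by (intro sum.cong) (auto simp: degG de)
      ultimately show "(\<Sum>i\<in>{1..r}. e i + k) \<le>
          r * (r - 1) + (\<Sum>i\<in>{1..n} - {1..r}. min r (e i + k))"
        using erdos_gallai_necessary[OF G, of "{1..r}"] r by simp
    qed
  qed
  obtain H where H: "simple_graph {1..n} H" and degH: "\<And>i. i \<in> {1..n} \<Longrightarrow> degree H i = e i"
    using erdos_gallai graphic_iff by blast
  obtain G' where G': "simple_graph {1..n} G'" and deg': "\<And>v. degree G' v = degree G v"
    and factor: "has_factor k {1..n} G'"
    using kundu[OF G H, of k] degG degH de by metis
  have "realization n d {1..n} G'"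
    unfolding realization_def using G' deg' degG bij_betw_id[of "{1..n}"] by (metis id_apply)
  with factor show ?thesis by blast
qed

end
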